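(* Let $K,N,M,\aleph$ be positive integers with $M<N$, and let $\rho\in\mathbb{C}^K$ be $M$-sparse. Let $\mathcal{A}\in\mathbb{C}^{N\times K}$ be a fixed matrix with columns $a_1,\dots,a_K\in\mathbb{C}^N$, and for $q=1,\dots,\aleph$ let $\Lambda_q=\mathrm{diag}(l_{1q},l_{2q},\dots,l_{Kq})\in\mathbb{C}^{K\times K}$ be diagonal matrices. Let $b_q\in\mathbb{C}^N$ be the (noiseless) data vectors $$\mathcal{A}\,\Lambda_q\,\rho=b_q,\qquad q=1,\dots,\aleph,$$ and let $B\in\mathbb{C}^{N\times\aleph}$ be the data matrix whose columns are $b_1,\dots,b_\aleph$. Assume that every set of $M+1$ columns of $\mathcal{A}$ is linearly independent and that $\operatorname{rank}(B)=M$. Then MUSIC provides the exact support of $\rho$; that is, $$\operatorname{supp}(\rho)=\{k\in\{1,\dots,K\}:\ P_{R(B)^\perp}\,a_k=0\}.$$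
   Context: $\operatorname{supp}(\rho)=\{k:\rho_k\neq 0\}$. "$M$-sparse" means that $T=\operatorname{supp}(\rho)$ has cardinality $|T|=M$. $R(B)\subset\mathbb{C}^N$ is the range (column space) of $B$, and $P_{R(B)^\perp}$ is the orthogonal projection of $\mathbb{C}^N$ onto its orthogonal complement (the left nullspace of $B$, called the noise subspace). The MUSIC algorithm takes $B$ and $\mathcal{A}$ as input and returns as estimated support the zero set of the orthogonal projections of the columns of $\mathcal{A}$ onto the noise subspace, i.e. the set of indices $k$ with $P_{R(B)^\perp}a_k=0$. *)

theory Defs
  imports "HOL-Analysis.Analysis"
begin

definition supp :: "complex ^ 'k::finite \<Rightarrow> 'k set" where
  "supp \<rho> = {k. \<rho> $ k \<noteq> 0}"

definition diag :: "('k::finite \<Rightarrow> complex) \<Rightarrow> complex ^ 'k ^ 'k" where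
  "diag d = (\<chi> i j. if i = j then d i else 0)"

text \<open>The library's inner product on \<^typ>\<open>complex ^ 'n\<close> is the real one, i.e. the real part of
  the Hermitian product. Orthogonality in complex coordinate space refers to the latter.\<close>

definition cinner :: "complex ^ 'n::finite \<Rightarrow> complex ^ 'n \<Rightarrow> complex" where
  "cinner x y = (\<Sum>i\<in>UNIV. x $ i * cnj (y $ i))"

definition cperp :: "(complex ^ 'n::finite) set \<Rightarrow> (complex ^ 'n) set" where
  "cperp S = {x. \<forall>y\<in>S. cinner x y = 0}"

text \<open>Meaningful for complex subspaces, where such a point exists and is unique
  (\<open>orth_proj_ex1\<close> below).\<close>

definition orth_proj :: "(complex ^ 'n::finite) set \<Rightarrow> complex ^ 'n \<Rightarrow> complex ^ 'n" where
  "orth_proj S v = (THE p. p \<in> S \<and> v - p \<in> cperp S)"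

definition col_range :: "complex ^ 'q::finite ^ 'n::finite \<Rightarrow> (complex ^ 'n) set" where
  "col_range B = range ((*v) B)"

definition music_support ::
    "complex ^ 'q::finite ^ 'n::finite \<Rightarrow> complex ^ 'k::finite ^ 'n \<Rightarrow> 'k set" where
  "music_support B A = {k. orth_proj (cperp (col_range B)) (column k A) = 0}"

lemma Re_cinner: "Re (cinner x y) = x \<bullet> y"
  by (simp add: cinner_def inner_vec_def inner_complex_def)

lemma cinner_scale_right: "cinner x (c *s y) = cnj c * cinner x y"
  by (simp add: cinner_def sum_distrib_left mult_ac)

lemma cinner_scale_left: "cinner (c *s x) y = c * cinner x y"
  by (simp add: cinner_def sum_distrib_left mult_ac)

lemma cinner_add_left: "cinner (x + y) z = cinner x z + cinner y z"
  by (simp add: cinner_def sum.distrib algebra_simps)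

lemma Im_cinner: "Im (cinner x y) = x \<bullet> (\<i> *s y)"
  using Re_cinner[of x "\<i> *s y"] by (simp add: cinner_scale_right)

lemma subspace_col_range: "vec.subspace (col_range B)"
  unfolding col_range_def by (rule vec.subspace_image[OF vec.subspace_UNIV])

lemma subspace_cperp: "vec.subspace (cperp S)"
  by (auto simp: vec.subspace_def cperp_def cinner_scale_left cinner_add_left)
     (simp add: cinner_def)

lemma orth_proj_ex1:
  assumes S: "vec.subspace S"
  shows "\<exists>!p. p \<in> S \<and> v - p \<in> cperp S"
proof -
  have real_scale: "complex_of_real r *s x = r *\<^sub>R x" for r and x :: "complex ^ 'n"
    by (simp add: vec_eq_iff, simp add: scaleR_conv_of_real)
  have sub: "subspace S"
    using S by (auto simp: vec.subspace_def subspace_def simp flip: real_scale)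
  obtain p z where p: "p \<in> span S" and z: "\<And>w. w \<in> span S \<Longrightarrow> orthogonal z w"
    and v: "v = p + z"
    using orthogonal_subspace_decomp_exists by metis
  have sp: "span S = S" using sub by (simp add: span_eq_iff)
  have iS: "\<i> *s w \<in> S" if "w \<in> S" for w
    using S that by (simp add: vec.subspace_def)
  have "cinner z w = 0" if "w \<in> S" for w
    using z[unfolded sp, OF that] z[unfolded sp, OF iS[OF that]]
    by (simp add: complex_eq_iff Re_cinner Im_cinner orthogonal_def)
  then have ex: "p \<in> S \<and> v - p \<in> cperp S"
    using p v by (simp add: sp cperp_def)
  have "q = p'" if q: "q \<in> S \<and> v - q \<in> cperp S" and p': "p' \<in> S \<and> v - p' \<in> cperp S" for q p'
  proof -
    have d: "q - p' \<in> S" using q p' sub by (simp add: subspace_diff)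
    have "(v - p') \<bullet> (q - p') = 0" "(v - q) \<bullet> (q - p') = 0"
      using q p' d by (auto simp: cperp_def simp flip: Re_cinner)
    then have "((v - p') - (v - q)) \<bullet> (q - p') = 0" by (simp only: inner_diff_left)
    then show ?thesis by simp
  qed
  with ex show ?thesis by blast
qed

end

theory Submission
  imports Defs
begin

text \<open>The range of \<open>B\<close> lies in the span of the \<open>M\<close> columns of \<open>A\<close> indexed by the support, and
  since \<open>B\<close> has rank \<open>M\<close> the two coincide. A column outside the support is not in that span, because
  together with the \<open>M\<close> columns of the support it forms an independent family.\<close>

lemma cinner_commute: "cinner x y = cnj (cinner y x)"
  by (simp add: cinner_def mult.commute)

lemma cinner_self_eq_0_iff: "cinner x x = 0 \<longleftrightarrow> x = 0"
  by (metis Re_cinner cinner_scale_left inner_eq_zero_iff mult_zero_left vector_smult_lzero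
      zero_complex.sel(1))

text \<open>For \<open>x\<close> in the double complement, let \<open>p\<close> be its projection
  onto \<open>S\<close>. Then \<open>x - p\<close> lies in both \<open>cperp S\<close> and
  \<open>cperp (cperp S)\<close>, so it is orthogonal to itself and vanishes.\<close>

lemma cperp_cperp:
  assumes "vec.subspace S"
  shows "cperp (cperp S) = S"
proof
  show "S \<subseteq> cperp (cperp S)"
    unfolding cperp_def by clarsimp (metis cinner_commute complex_cnj_zero)
  show "cperp (cperp S) \<subseteq> S"
  proof
    fix x assume x: "x \<in> cperp (cperp S)"
    obtain p where p: "p \<in> S" "x - p \<in> cperp S"
      using orth_proj_ex1[OF assms] by blast
    have "p \<in> cperp (cperp S)"
      using p(1) \<open>S \<subseteq> cperp (cperp S)\<close> by blast
    with x have "x - p \<in> cperp (cperp S)"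
      by (simp add: subspace_cperp vec.subspace_diff)
    with p(2) have "cinner (x - p) (x - p) = 0"
      by (simp add: cperp_def)
    with p(1) show "x \<in> S"
      by (simp add: cinner_self_eq_0_iff)
  qed
qed

text \<open>The projection is the unique point with its defining property, and \<open>0\<close> has
  that property exactly when \<open>v - 0\<close> lies in \<open>cperp S\<close>.\<close>

lemma orth_proj_eq_0_iff:
  assumes "vec.subspace S"
  shows "orth_proj S v = 0 \<longleftrightarrow> v \<in> cperp S"
proof -
  have "orth_proj S v \<in> S \<and> v - orth_proj S v \<in> cperp S"
    unfolding orth_proj_def by (rule theI'[OF orth_proj_ex1[OF assms]])
  moreover have "0 \<in> S"
    using assms by (rule vec.subspace_0)
  ultimately show ?thesis
    using orth_proj_ex1[OF assms, of v] by force
qed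

text \<open>Being annihilated by the projection onto the noise subspace means lying in its
  complement, which is the range again. From here on no orthogonality is involved.\<close>

lemma music_support_iff: "k \<in> music_support B A \<longleftrightarrow> column k A \<in> col_range B"
  by (simp add: music_support_def orth_proj_eq_0_iff subspace_cperp cperp_cperp subspace_col_range)

lemma col_range_eq_span_columns: "col_range B = vec.span (columns B)"
proof
  show "col_range B \<subseteq> vec.span (columns B)"
    by (auto simp: col_range_def matrix_vector_mult_in_columnspace_gen)
  have "column q B = B *v axis q 1" for q
    by (simp add: vec_eq_iff column_def matrix_vector_mult_def axis_def if_distrib cong: if_cong)
  then have "columns B \<subseteq> col_range B"
    by (auto simp: columns_def col_range_def)
  then show "vec.span (columns B) \<subseteq> col_range B"
    by (simp add: subspace_col_range vec.span_minimal)
qed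

text \<open>Writing the columns in a basis \<open>C\<close> of their span expresses every row through the \<open>card C\<close>
  vectors of coordinates.\<close>

lemma dim_rows_le_dim_columns:
  fixes B :: "'a::field ^ 'q ^ 'n"
  shows "vec.dim (rows B) \<le> vec.dim (columns B)"
proof -
  obtain C where C: "vec.independent C" "columns B \<subseteq> vec.span C" "card C = vec.dim (columns B)"
    by (rule vec.basis_exists[of "columns B"]) blast
  have fin: "finite C"
    using C(1) by (rule vec.finiteI_independent)
  have "\<exists>u. column q B = (\<Sum>c\<in>C. u c *s c)" for q
    using C(2) fin by (auto simp: columns_def vec.span_finite)
  then obtain u where u: "\<And>q. column q B = (\<Sum>c\<in>C. u q c *s c)"
    by metis
  let ?w = "\<lambda>c. \<chi> q. u q c"
  have "row i B = (\<Sum>c\<in>C. c $ i *s ?w c)" for i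
  proof (rule vec_eq_iff[THEN iffD2], rule allI)
    fix q
    have "row i B $ q = column q B $ i"
      by (simp add: row_def column_def)
    then show "row i B $ q = (\<Sum>c\<in>C. c $ i *s ?w c) $ q"
      by (simp add: u mult.commute)
  qed
  moreover have "(\<Sum>c\<in>C. c $ i *s ?w c) \<in> vec.span (?w ` C)" for i
    by (intro vec.span_sum vec.span_scale vec.span_base imageI)
  ultimately have "rows B \<subseteq> vec.span (?w ` C)"
    by (auto simp: rows_def)
  then have "vec.dim (rows B) \<le> card (?w ` C)"
    using fin by (intro vec.dim_le_card) auto
  also have "\<dots> \<le> vec.dim (columns B)"
    using fin C(3) card_image_le by metis
  finally show ?thesis .
qed

text \<open>\<open>rank\<close> is by definition the dimension of the rows. Transposing swaps rows
  and columns, so the previous inequality yields both directions.\<close>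

lemma dim_columns_eq_rank: "vec.dim (columns B) = rank B"
  using dim_rows_le_dim_columns[of B] dim_rows_le_dim_columns[of "transpose B"]
  by (simp add: row_rank_def_gen)

lemma dim_col_range: "vec.dim (col_range B) = rank B"
  by (simp add: col_range_eq_span_columns dim_columns_eq_rank)

lemma diag_mult_vec: "diag d *v x = (\<chi> k. d k * x $ k)"
  by (simp add: diag_def matrix_vector_mult_def vec_eq_iff if_distrib[of "\<lambda>c. c * _"] cong: if_cong)

text \<open>The product combines the columns of \<open>A\<close> with coefficients
  \<open>d k * \<rho> $ k\<close>, which vanish off the support whatever \<open>d\<close>
  is.\<close>

lemma mult_diag_in_span_supp:
  "(A ** diag d) *v \<rho> \<in> vec.span ((\<lambda>k. column k A) ` supp \<rho>)"
proof -
  have "(A ** diag d) *v \<rho> = (\<Sum>k\<in>UNIV. (d k * \<rho> $ k) *s column k A)"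
    by (simp add: diag_mult_vec matrix_mult_sum[of A] flip: matrix_vector_mul_assoc)
  also have "\<dots> = (\<Sum>k\<in>supp \<rho>. (d k * \<rho> $ k) *s column k A)"
    by (rule sum.mono_neutral_right) (auto simp: supp_def)
  also have "\<dots> \<in> vec.span ((\<lambda>k. column k A) ` supp \<rho>)"
    by (intro vec.span_sum vec.span_scale vec.span_base imageI)
  finally show ?thesis .
qed

theorem proposition1:
  fixes A :: "complex ^ 'k::finite ^ 'n::finite"
    and \<rho> :: "complex ^ 'k"
    and l :: "'k \<Rightarrow> 'q::finite \<Rightarrow> complex"
    and \<Lambda> :: "'q \<Rightarrow> complex ^ 'k ^ 'k"
    and b :: "'q \<Rightarrow> complex ^ 'n"
    and B :: "complex ^ 'q ^ 'n"
    and M :: nat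
  assumes "0 < M" and "M < CARD('n)"
    and "card (supp \<rho>) = M"
    and "\<And>q. \<Lambda> q = diag (\<lambda>k. l k q)"
    and "\<And>q. (A ** \<Lambda> q) *v \<rho> = b q"
    and "\<And>q. column q B = b q"
    and "\<And>S. card S = M + 1 \<Longrightarrow>
           inj_on (\<lambda>k. column k A) S \<and> vec.independent ((\<lambda>k. column k A) ` S)"
    and "rank B = M"
  shows "supp \<rho> = music_support B A"
proof -
  let ?C = "(\<lambda>k. column k A) ` supp \<rho>"
  have "columns B \<subseteq> vec.span ?C"
    using mult_diag_in_span_supp[of A _ \<rho>] assms(4-6) by (auto simp: columns_def) metis
  then have sub: "col_range B \<subseteq> vec.span ?C"
    by (simp add: col_range_eq_span_columns vec.span_minimal)
  \<comment> \<open>Both bounds pass through \<open>card ?C\<close>, which is at most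
    \<open>M = rank B\<close>. With the inclusion \<open>sub\<close>, this forces the two subspaces
    to be equal.\<close>
  have "vec.dim (vec.span ?C) \<le> card ?C"
    by (simp add: vec.dim_le_card')
  also have "\<dots> \<le> vec.dim (col_range B)"
    using assms(3,8) card_image_le[of "supp \<rho>"] by (simp add: dim_col_range)
  finally have range: "col_range B = vec.span ?C"
    using sub by (simp add: vec.subspace_dim_equal subspace_col_range)
  show ?thesis
  proof (rule set_eqI)
    fix k
    have "column k A \<notin> vec.span ?C" if k: "k \<notin> supp \<rho>"
    proof -
      have "card (insert k (supp \<rho>)) = M + 1"
        using k assms(3) by simp
      \<comment> \<open>Injectivity on the \<open>M + 1\<close> indices keeps the new column out of
        \<open>?C\<close>. If it repeated an old one, independence of the set would not exclude it
        from the span.\<close>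
      from assms(7)[OF this] k have "vec.independent (insert (column k A) ?C)"
        and "column k A \<notin> ?C"
        by auto
      then show ?thesis
        by (simp add: vec.independent_insert)
    qed
    then show "k \<in> supp \<rho> \<longleftrightarrow> k \<in> music_support B A"
      by (auto simp: music_support_iff range intro: vec.span_base)
  qed
qed

end
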